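(* For every integer $n\ge 1$, \[ \ell_q\big(\{1,2,\ldots,n\}\big)=\frac12\left(\frac{n(n+1)}{2}+\left\lceil\frac n2\right\rceil\right). \]
   Context: All graphs are finite and simple. The degree set of a graph is the set of distinct degrees of its vertices. For a finite nonempty set $\mathscr D$ of positive integers, $\ell_q(\mathscr D)$ denotes the least number of edges of a simple graph whose degree set is exactly $\mathscr D$. *)

theory Defs
  imports Complex_Main "HOL-Library.Ramsey" "HOL-Library.Nat_Bijection"
begin

definition simple_graph :: "'a set \<Rightarrow> 'a set set \<Rightarrow> bool" where
  "simple_graph V E \<longleftrightarrow> finite V \<and> E \<subseteq> [V]\<^bsup>2\<^esup>"

definition vertex_degree :: "'a set set \<Rightarrow> 'a \<Rightarrow> nat" where
  "vertex_degree E v = card {e \<in> E. v \<in> e}"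

definition degree_set :: "'a set \<Rightarrow> 'a set set \<Rightarrow> nat set" where
  "degree_set V E = vertex_degree E ` V"

(* Vertices are natural numbers without loss of generality, since every finite graph is
   isomorphic to one on such a vertex set (see min_edges_le for arbitrary vertex types).
   The minimum is attained by ex_graph_with_degree_set. *)
definition min_edges :: "nat set \<Rightarrow> nat" (\<open>\<l>\<^sub>q\<close>) where
  "\<l>\<^sub>q D = (LEAST m. \<exists>(V :: nat set) E. simple_graph V E \<and> degree_set V E = D \<and> card E = m)"

lemma simple_graph_image:
  assumes G: "simple_graph V E" and f: "inj_on f V"
  shows "simple_graph (f ` V) ((`) f ` E)"
    and "degree_set (f ` V) ((`) f ` E) = degree_set V E"
    and "card ((`) f ` E) = card E"
proof -
  have sub: "e \<subseteq> V" "finite e" "card e = 2" if "e \<in> E" for e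
    using G that by (auto simp: simple_graph_def nsets_def)
  have card2: "card (f ` e) = 2" if "e \<in> E" for e
    using sub[OF that] f by (metis card_image inj_on_subset)
  have inj: "inj_on ((`) f) E"
    using sub(1) f by (meson inj_onI inj_on_image_eq_iff)
  show "simple_graph (f ` V) ((`) f ` E)"
    using G sub card2 by (fastforce simp: simple_graph_def nsets_def)
  show "card ((`) f ` E) = card E"
    using inj by (rule card_image)
  have "vertex_degree ((`) f ` E) (f v) = vertex_degree E v" if v: "v \<in> V" for v
  proof -
    have "{e \<in> (`) f ` E. f v \<in> e} = (`) f ` {e \<in> E. v \<in> e}"
    proof -
      have "f v \<in> f ` e \<longleftrightarrow> v \<in> e" if "e \<in> E" for e
        using inj_on_image_mem_iff[OF f v sub(1)[OF that]] .
      then show ?thesis by blast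
    qed
    moreover have "inj_on ((`) f) {e \<in> E. v \<in> e}"
      using inj by (rule inj_on_subset) auto
    ultimately show ?thesis by (simp add: vertex_degree_def card_image)
  qed
  then show "degree_set (f ` V) ((`) f ` E) = degree_set V E"
    by (auto simp: degree_set_def image_image)
qed

lemma min_edges_le:
  fixes V :: "'a set"
  assumes G: "simple_graph V E" and D: "degree_set V E = D"
  shows "\<l>\<^sub>q D \<le> card E"
proof -
  obtain f :: "'a \<Rightarrow> nat" where f: "inj_on f V"
    using G finite_imp_inj_to_nat_seg unfolding simple_graph_def by metis
  show ?thesis
    unfolding min_edges_def using simple_graph_image[OF G f] D by (intro Least_le) blast
qed

text \<open>A disjoint union of complete graphs on \<open>d + 1\<close> vertices, for \<open>d \<in> D\<close>.\<close>

lemma ex_graph_with_degree_set: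
  assumes "finite D"
  shows "\<exists>(V :: nat set) E. simple_graph V E \<and> degree_set V E = D"
proof -
  define V where "V = Sigma D (\<lambda>d. {..d})"
  define E where "E = (\<Union>d\<in>D. [{d} \<times> {..d}]\<^bsup>2\<^esup>)"
  have G: "simple_graph V E"
    using assms by (force simp: simple_graph_def V_def E_def nsets_def)
  have deg: "vertex_degree E (d, i) = d" if d: "d \<in> D" "i \<le> d" for d i
  proof -
    have "{e \<in> E. (d, i) \<in> e} = (\<lambda>j. {(d, i), (d, j)}) ` ({..d} - {i})"
    proof (intro equalityI subsetI)
      fix e assume "e \<in> {e \<in> E. (d, i) \<in> e}"
      then have e: "e \<subseteq> {d} \<times> {..d}" "card e = 2" "(d, i) \<in> e"
        by (auto simp: E_def nsets_def)
      then obtain y where "e = {(d, i), y}" "y \<noteq> (d, i)"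
        by (auto simp: card_2_iff)
      then show "e \<in> (\<lambda>j. {(d, i), (d, j)}) ` ({..d} - {i})"
        using e by auto
    next
      fix e assume "e \<in> (\<lambda>j. {(d, i), (d, j)}) ` ({..d} - {i})"
      then show "e \<in> {e \<in> E. (d, i) \<in> e}"
        using d by (auto simp: E_def nsets_def intro!: bexI[of _ d])
    qed
    moreover have "inj_on (\<lambda>j. {(d, i), (d, j)}) ({..d} - {i})"
      by (auto simp: inj_on_def doubleton_eq_iff)
    ultimately show ?thesis
      using d by (simp add: vertex_degree_def card_image)
  qed
  have "degree_set V E = D"
  proof
    show "degree_set V E \<subseteq> D"
      using deg by (auto simp: degree_set_def V_def)
    show "D \<subseteq> degree_set V E"
    proof
      fix d assume "d \<in> D"
      then have "(d, 0) \<in> V" "vertex_degree E (d, 0) = d"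
        using deg by (auto simp: V_def)
      then show "d \<in> degree_set V E"
        unfolding degree_set_def by (metis imageI)
    qed
  qed
  then show ?thesis
    using simple_graph_image[OF G, of prod_encode] inj_prod_encode by blast
qed

end

theory Submission
  imports Defs
begin

text \<open>
  Put \<open>k = \<lfloor>n/2\<rfloor>\<close> and \<open>h = \<lceil>n/2\<rceil>\<close>; the claimed value is \<open>h (k + 1)\<close>. For the lower bound, choose
  vertices of degrees \<open>k + 1, \<dots>, n\<close>. Summing these \<open>h\<close> degrees counts twice at most
  \<open>h (h - 1) / 2\<close> edges, so at least \<open>(k + 1) + \<dots> + n - h (h - 1) / 2 = h (k + 1)\<close> edges are incident
  with the chosen vertices. Equality holds for the antiregular graph on \<open>{1, \<dots>, n + 1}\<close>, in which
  \<open>x \<noteq> y\<close> are adjacent iff \<open>x + y > n + 1\<close>: the vertex \<open>x\<close> has degree \<open>x\<close> or \<open>x - 1\<close> according to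
  whether \<open>2 x \<le> n + 1\<close>.
\<close>

text \<open>An edge meeting \<open>S\<close> is counted once or twice, and twice only if both ends
  lie in \<open>S\<close>; each pair of vertices of \<open>S\<close> carries at most one
  edge.\<close>

lemma sum_vertex_degree_le:
  assumes E: "finite E" "\<And>e. e \<in> E \<Longrightarrow> card e = 2" and S: "finite S"
  shows "(\<Sum>v\<in>S. vertex_degree E v) \<le> card {e \<in> E. e \<inter> S \<noteq> {}} + (card S choose 2)"
  using S
proof (induction S rule: finite_induct)
  case empty
  then show ?case by simp
next
  case (insert v S)
  \<comment> \<open>Adding \<open>v\<close> recounts the edges of \<open>?A\<close>, at most one for
    each vertex of \<open>S\<close>, while those of \<open>?B\<close> are newly covered.\<close>
  let ?A = "{e \<in> E. v \<in> e \<and> e \<inter> S \<noteq> {}}" and ?B = "{e \<in> E. v \<in> e \<and> e \<inter> S = {}}"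
  have "?A \<subseteq> (\<lambda>w. {v, w}) ` S"
  proof
    fix e assume e: "e \<in> ?A"
    then obtain w where w: "w \<in> e" "w \<in> S" by auto
    with insert.hyps e have "v \<noteq> w" "v \<in> e" "card e = 2" using E by auto
    with w have "e = {v, w}" by (auto simp: card_2_iff)
    with w show "e \<in> (\<lambda>w. {v, w}) ` S" by auto
  qed
  then have A: "card ?A \<le> card S"
    using insert.hyps by (meson card_image_le card_mono finite_imageI le_trans)
  have "{e \<in> E. v \<in> e} = ?A \<union> ?B" by auto
  moreover have "card (?A \<union> ?B) = card ?A + card ?B"
    using E by (intro card_Un_disjoint) auto
  ultimately have deg: "vertex_degree E v = card ?A + card ?B"
    by (simp add: vertex_degree_def)
  have "{e \<in> E. e \<inter> insert v S \<noteq> {}} = {e \<in> E. e \<inter> S \<noteq> {}} \<union> ?B" by auto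
  moreover have "card ({e \<in> E. e \<inter> S \<noteq> {}} \<union> ?B) = card {e \<in> E. e \<inter> S \<noteq> {}} + card ?B"
    using E by (intro card_Un_disjoint) auto
  moreover have "card (insert v S) choose 2 = (card S choose 2) + card S"
    using insert.hyps by (simp add: numeral_2_eq_2)
  ultimately show ?case
    using insert A deg by simp
qed

lemma sum_shifted_interval: "(\<Sum>i\<in>{k+1..k+h}. i) = h * (k + 1) + (h choose 2)"
  for h k :: nat
  by (induction h) (simp_all add: numeral_2_eq_2)

lemma card_edges_ge:
  assumes G: "simple_graph V E" and D: "{k+1..k+h} \<subseteq> degree_set V E"
  shows "h * (k + 1) \<le> card E"
proof -
  from G have E: "finite E" "\<And>e. e \<in> E \<Longrightarrow> card e = 2"
    by (auto simp: simple_graph_def nsets_def intro: finite_subset[of _ "Pow V"])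
  have "\<forall>i\<in>{k+1..k+h}. \<exists>v. vertex_degree E v = i"
    using D by (auto simp: degree_set_def)
  then obtain f where f: "\<And>i. i \<in> {k+1..k+h} \<Longrightarrow> vertex_degree E (f i) = i"
    by metis
  \<comment> \<open>Distinct degrees force distinct vertices, so exactly \<open>h\<close> vertices
    are chosen.\<close>
  then have inj: "inj_on f {k+1..k+h}"
    by (metis inj_onI)
  have "h * (k + 1) + (h choose 2) = (\<Sum>i\<in>{k+1..k+h}. vertex_degree E (f i))"
    unfolding sum_shifted_interval[symmetric] using f by (intro sum.cong) auto
  also have "\<dots> = (\<Sum>v\<in>f ` {k+1..k+h}. vertex_degree E v)"
    by (simp only: sum.reindex[OF inj] o_def)
  also have "\<dots> \<le> card {e \<in> E. e \<inter> f ` {k+1..k+h} \<noteq> {}} + (h choose 2)"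
    using sum_vertex_degree_le[OF E, of "f ` {k+1..k+h}"] card_image[OF inj] by simp
  also have "\<dots> \<le> card E + (h choose 2)"
    using E by (simp add: card_mono)
  finally show ?thesis by simp
qed

text \<open>Listing each edge once, larger end first, turns the edge count into a sum over
  \<open>x\<close>. As \<open>n + 2 - x\<close> is positive for every listed \<open>x\<close>, 0 is
  never an end.\<close>

definition antiregular_edges :: "nat \<Rightarrow> nat set set" where
  "antiregular_edges n = (\<lambda>(x, y). {x, y}) ` (SIGMA x:{..n+1}. {n+2-x..<x})"

lemma doubleton_in_antiregular_edges_iff:
  "{x, y} \<in> antiregular_edges n \<longleftrightarrow> x \<noteq> y \<and> x \<le> n + 1 \<and> y \<le> n + 1 \<and> n + 1 < x + y"
proof
  assume "{x, y} \<in> antiregular_edges n"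
  then show "x \<noteq> y \<and> x \<le> n + 1 \<and> y \<le> n + 1 \<and> n + 1 < x + y"
    by (auto simp: antiregular_edges_def doubleton_eq_iff)
next
  assume "x \<noteq> y \<and> x \<le> n + 1 \<and> y \<le> n + 1 \<and> n + 1 < x + y"
  then have "(x, y) \<in> (SIGMA x:{..n+1}. {n+2-x..<x}) \<or> (y, x) \<in> (SIGMA x:{..n+1}. {n+2-x..<x})"
    by auto
  then show "{x, y} \<in> antiregular_edges n"
    unfolding antiregular_edges_def by (force simp: insert_commute)
qed

lemma simple_graph_antiregular: "simple_graph {1..n+1} (antiregular_edges n)"
  by (auto simp: simple_graph_def antiregular_edges_def nsets_def)

text \<open>Subtraction truncates, so only the upper half of the range contributes. Raising
  \<open>n\<close> by 2 and shifting \<open>x\<close> by 1 preserves the summands, leaving just one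
  new top term, \<open>n + 2\<close>.\<close>

lemma sum_twice_minus:
  "(\<Sum>x\<le>n+1. 2 * x - (n + 2)) = (n + 1) div 2 * (n div 2 + 1)" for n :: nat
proof (induction n rule: nat_induct2)
  case (step n)
  have "(\<Sum>x\<le>n+2+1. 2 * x - (n + 2 + 2)) = (\<Sum>x\<le>n+2. 2 * x - (n + 2))"
    using sum.atMost_Suc_shift[of "\<lambda>x. 2 * x - (n + 2 + 2)" "n + 2"] by simp
  also have "\<dots> = (\<Sum>x\<le>n+1. 2 * x - (n + 2)) + (n + 2)"
    by simp
  also have "\<dots> = (n + 1) div 2 * (n div 2 + 1) + (n + 2)"
    by (simp only: step)
  also have "\<dots> = (n + 2 + 1) div 2 * ((n + 2) div 2 + 1)"
    by (cases "even n") (auto elim!: evenE oddE simp: algebra_simps)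
  finally show ?case .
qed simp_all

lemma card_antiregular_edges: "card (antiregular_edges n) = (n + 1) div 2 * (n div 2 + 1)"
proof -
  have "inj_on (\<lambda>(x, y). {x, y}) (SIGMA x:{..n+1}. {n+2-x..<x})"
    by (auto simp: inj_on_def doubleton_eq_iff)
  then have "card (antiregular_edges n) = (\<Sum>x\<le>n+1. x - (n + 2 - x))"
    by (simp add: antiregular_edges_def card_image)
  \<comment> \<open>Here \<open>n + 2 - x\<close> is not truncated, since
    \<open>x \<le> n + 1\<close>.\<close>
  also have "\<dots> = (\<Sum>x\<le>n+1. 2 * x - (n + 2))"
    by (intro sum.cong) auto
  finally show ?thesis
    by (simp only: sum_twice_minus)
qed

text \<open>The interval \<open>{n+2-x..n+1}\<close> has \<open>x\<close> elements; removing
  \<open>x\<close> itself costs one exactly when \<open>2 * x > n + 1\<close>.\<close>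

lemma vertex_degree_antiregular:
  assumes x: "x \<in> {1..n+1}"
  shows "vertex_degree (antiregular_edges n) x = (if 2 * x \<le> n + 1 then x else x - 1)"
proof -
  have "{e \<in> antiregular_edges n. x \<in> e} = (\<lambda>y. {x, y}) ` ({n+2-x..n+1} - {x})"
  proof (intro equalityI subsetI)
    fix e assume e: "e \<in> {e \<in> antiregular_edges n. x \<in> e}"
    then obtain y where "e = {x, y}"
      by (auto simp: antiregular_edges_def)
    with e show "e \<in> (\<lambda>y. {x, y}) ` ({n+2-x..n+1} - {x})"
      using doubleton_in_antiregular_edges_iff[of x y n] by auto
  next
    fix e assume "e \<in> (\<lambda>y. {x, y}) ` ({n+2-x..n+1} - {x})"
    then show "e \<in> {e \<in> antiregular_edges n. x \<in> e}"
      using x by (auto simp: doubleton_in_antiregular_edges_iff)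
  qed
  moreover have "inj_on (\<lambda>y. {x, y}) ({n+2-x..n+1} - {x})"
    by (auto simp: inj_on_def doubleton_eq_iff)
  ultimately have "vertex_degree (antiregular_edges n) x = card ({n+2-x..n+1} - {x})"
    by (simp add: vertex_degree_def card_image)
  then show ?thesis
    using x by (auto simp: card_Diff_singleton_if)
qed

lemma degree_set_antiregular:
  assumes "n \<ge> 1"
  shows "degree_set {1..n+1} (antiregular_edges n) = {1..n}"
proof -
  let ?d = "\<lambda>x. if 2 * x \<le> n + 1 then x else x - 1"
  have "degree_set {1..n+1} (antiregular_edges n) = ?d ` {1..n+1}"
    unfolding degree_set_def by (intro image_cong refl vertex_degree_antiregular)
  also have "\<dots> = {1..n}"
  proof
    \<comment> \<open>Degree 0 could come only from \<open>x = 1\<close> with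
      \<open>2 > n + 1\<close>, which \<open>n \<ge> 1\<close> excludes.\<close>
    show "?d ` {1..n+1} \<subseteq> {1..n}" using assms by auto
    show "{1..n} \<subseteq> ?d ` {1..n+1}"
    proof
      fix i assume i: "i \<in> {1..n}"
      show "i \<in> ?d ` {1..n+1}"
      proof (cases "2 * i \<le> n + 1")
        case True
        with i show ?thesis by (intro image_eqI[of _ _ i]) auto
      next
        \<comment> \<open>Beyond the middle, degrees lag one behind the labels, so \<open>i\<close>
          is attained at \<open>i + 1\<close>.\<close>
        case False
        with i show ?thesis by (intro image_eqI[of _ _ "i + 1"]) auto
      qed
    qed
  qed
  finally show ?thesis .
qed

lemma min_edges_interval:
  assumes "n \<ge> 1"
  shows "\<l>\<^sub>q {1..n} = (n + 1) div 2 * (n div 2 + 1)"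
proof (rule antisym)
  show "\<l>\<^sub>q {1..n} \<le> (n + 1) div 2 * (n div 2 + 1)"
    using min_edges_le[OF simple_graph_antiregular degree_set_antiregular[OF assms]]
    by (simp add: card_antiregular_edges)
  have "\<exists>m (V :: nat set) E. simple_graph V E \<and> degree_set V E = {1..n} \<and> card E = m"
    using ex_graph_with_degree_set[of "{1..n}"] by blast
  from LeastI_ex[OF this] obtain V :: "nat set" and E
    where G: "simple_graph V E" "degree_set V E = {1..n}" "card E = \<l>\<^sub>q {1..n}"
    unfolding min_edges_def by blast
  \<comment> \<open>Hence the top \<open>h\<close> degrees \<open>k + 1, ..., k + h\<close> end
    exactly at \<open>n\<close>.\<close>
  have "n div 2 + (n + 1) div 2 = n" by linarith
  then show "(n + 1) div 2 * (n div 2 + 1) \<le> \<l>\<^sub>q {1..n}"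
    using card_edges_ge[of V E "n div 2" "(n + 1) div 2"] G by simp
qed

theorem theorem6:
  fixes n :: nat
  assumes "n \<ge> 1"
  shows "real (\<l>\<^sub>q {1..n}) =
    1 / 2 * (real n * (real n + 1) / 2 + real_of_int \<lceil>real n / 2\<rceil>)"
proof (cases "even n")
  case True
  then obtain k where "n = 2 * k" by (elim evenE)
  then show ?thesis
    unfolding min_edges_interval[OF assms] by (simp add: field_simps)
next
  case False
  then obtain k where k: "n = 2 * k + 1" by (elim oddE)
  then have "\<lceil>real n / 2\<rceil> = int k + 1" by (simp add: ceiling_eq_iff)
  with k show ?thesis
    unfolding min_edges_interval[OF assms] by (simp add: field_simps)
qed

end
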